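(* Let $M>0$. If $P_n(z)=\sum_{k=0}^n a_{k,n}z^k\in\mathbb{Z}_n^s(D,M)$, $n\in\mathbb{N}$, then $$|a_{n-1,n}|\le 8M\sqrt{n\log n},\qquad n\ge\max(M,55).$$
   Context: $D:=\{z\in\mathbb{C}:|z|\le 1\}$ is the closed unit disk. $\mathbb{Z}_n^s(D,M)$ denotes the set of polynomials with integer coefficients, of exact degree $n$, all of whose zeros are simple and lie in $D$, and whose leading coefficient $a_{n,n}$ satisfies $|a_{n,n}|\le M$. $\log$ is the natural logarithm. *)

theory Defs
  imports Complex_Main "HOL-Computational_Algebra.Polynomial"
begin

text \<open>
  The set $\mathbb{Z}_n^s(D,M)$, for an arbitrary set of admissible zeros \<open>D\<close>. The zeros are the
  complex ones, so the integer polynomial is mapped to a complex one. The condition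
  \<open>P \<noteq> 0\<close> matters only for \<open>n = 0\<close>, since \<open>degree 0 = 0\<close>.
\<close>

definition int_polys_simple_zeros :: "nat \<Rightarrow> complex set \<Rightarrow> real \<Rightarrow> int poly set" where
  "int_polys_simple_zeros n D M =
     {P. P \<noteq> 0 \<and> degree P = n \<and>
         (\<forall>z::complex. poly (map_poly of_int P) z = 0 \<longrightarrow>
            z \<in> D \<and> order z (map_poly of_int P) = 1) \<and>
         real_of_int \<bar>lead_coeff P\<bar> \<le> M}"

definition closed_unit_disk :: "complex set" where
  "closed_unit_disk = {z. norm z \<le> 1}"

end

theory Submission
  imports
    Defs
    "HOL-Analysis.Complex_Transcendental"
    "HOL-Computational_Algebra.Fundamental_Theorem_Algebra"
    "Jordan_Normal_Form.Determinant"
begin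

text \<open>
  Let \<open>z\<^sub>1, \<dots>, z\<^sub>n\<close> be the zeros and \<open>a\<close> the leading coefficient of the polynomial. Up to the
  factor \<open>a\<close>, the second coefficient is the sum of the zeros, so the claim says that this sum has
  size \<open>O(sqrt (n log n))\<close>. Two opposing estimates for the energy
  \<open>D = (\<Sum>j\<noteq>k. ln \<bar>z\<^sub>j - z\<^sub>k\<bar>)\<close> give this.

  From below, arithmetic keeps the zeros apart. The resultant of an integer polynomial and its
  derivative is an integer, nonzero when the zeros are simple, and equals
  \<open>a\<close> to the power \<open>2n - 1\<close> times \<open>\<Prod>j\<noteq>k. (z\<^sub>j - z\<^sub>k)\<close> up to sign. Hence
  \<open>D \<ge> - (2n - 1) ln \<bar>a\<bar> \<ge> - 2n ln n\<close>; this is \<open>discriminant_lower_bound\<close>, which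
  rests on \<open>det_resultant_matrix\<close>.

  From above, points of the unit disk with a large sum lie close together, which makes \<open>D\<close>
  small. In the disk \<open>\<bar>z - w\<bar> \<le> \<bar>1 - z cnj w\<bar>\<close>, and the kernel \<open>ln \<bar>1 - z cnj w\<bar>\<close> is negative
  definite: its power series gives
  \<open>(\<Sum>z w. ln \<bar>1 - z cnj w\<bar>) = - (\<Sum>m\<ge>1. \<bar>\<Sum>z. z ^ m\<bar>\<^sup>2 / m)\<close>, where the term \<open>m = 1\<close> is
  the square of the sum in question and the other terms have the same sign. Since zeros may lie on
  the unit circle, where the diagonal of the kernel is infinite, all points are first contracted by
  the factor \<open>sqrt s\<close> with \<open>s = 1 - 1/n\<close>. The diagonal then costs at most \<open>n ln n\<close> and the
  contraction at most \<open>n/2\<close>; this is \<open>sum_norm_le_energy\<close>. Together,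
  \<open>s \<bar>\<Sum>z\<bar>\<^sup>2 \<le> 3 n ln n + n/2\<close>.
\<close>

unbundle no vec_syntax

section \<open>Integrality of the resultant\<close>

text \<open>
  The Sylvester matrix with its rows permuted and its columns reversed: the rows are the
  coefficient vectors, by ascending degree, of \<open>x ^ i * g\<close> for \<open>i < n\<close>, followed by those of
  \<open>x ^ i * f\<close> for \<open>i < m\<close>. Ascending order puts the powers of a root next to the coefficients
  in a matrix product. The numbers \<open>n\<close> and \<open>m\<close> are explicit so that \<open>m\<close> may exceed the degree
  of \<open>g\<close>.
\<close>

definition resultant_matrix :: "nat \<Rightarrow> nat \<Rightarrow> 'a::comm_ring_1 poly \<Rightarrow> 'a poly \<Rightarrow> 'a mat" where
  "resultant_matrix n m f g = Matrix.mat (n + m) (n + m)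
     (\<lambda>(i, j). coeff (if i < n then monom 1 i * g else monom 1 (i - n) * f) j)"

lemma poly_eq_sum_lessThan:
  fixes p :: "'a::comm_ring_1 poly"
  assumes "degree p < N"
  shows "poly p x = (\<Sum>j<N. coeff p j * x ^ j)"
proof -
  have "poly p x = (\<Sum>j\<le>degree p. coeff p j * x ^ j)"
    by (rule poly_altdef)
  also have "\<dots> = (\<Sum>j<N. coeff p j * x ^ j)"
    using assms by (intro sum.mono_neutral_left) (auto simp: not_le coeff_eq_0)
  finally show ?thesis .
qed

text \<open>
  A vector in the kernel of the transposed matrix is the coefficient vector of a polynomial of
  degree less than \<open>n\<close> that vanishes at the \<open>n\<close> distinct points.
\<close>

lemma det_vandermonde_nonzero:
  fixes z :: "nat \<Rightarrow> 'a::field"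
  assumes "inj_on z {..<n}"
  shows "det (Matrix.mat n n (\<lambda>(j, k). z k ^ j)) \<noteq> 0"
proof
  let ?V = "Matrix.mat n n (\<lambda>(j, k). z k ^ j)"
  assume "det ?V = 0"
  then have "det (transpose_mat ?V) = 0"
    by (simp add: det_transpose[of ?V n])
  then obtain v where v: "v \<in> carrier_vec n" "v \<noteq> 0\<^sub>v n"
      and ker: "transpose_mat ?V *\<^sub>v v = 0\<^sub>v n"
    using det_0_iff_vec_prod_zero_field[of "transpose_mat ?V" n] by auto
  define p where "p = (\<Sum>j<n. monom (v $ j) j)"
  have cf: "coeff p j = (if j < n then v $ j else 0)" for j
    unfolding p_def by (simp add: coeff_sum)
  obtain j0 where j0: "j0 < n" "v $ j0 \<noteq> 0"
    using v by (metis carrier_vecD eq_vecI index_zero_vec)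
  have deg: "degree p < n"
  proof -
    have "degree p \<le> n - 1"
      using j0(1) by (intro degree_le) (auto simp: cf)
    with j0(1) show ?thesis by linarith
  qed
  have root: "poly p (z k) = 0" if "k < n" for k
  proof -
    have "poly p (z k) = (\<Sum>j<n. coeff p j * z k ^ j)"
      by (rule poly_eq_sum_lessThan[OF deg])
    also have "\<dots> = (transpose_mat ?V *\<^sub>v v) $ k"
      using that v(1) by (auto simp: scalar_prod_def cf atLeast0LessThan mult.commute intro!: sum.cong)
    also have "\<dots> = 0"
      using that ker by simp
    finally show ?thesis .
  qed
  have "p = 0"
  proof (rule poly_eqI_degree[of "z ` {..<n}"])
    show "card (z ` {..<n}) > degree p" "card (z ` {..<n}) > degree (0 :: 'a poly)"
      using deg j0(1) by (auto simp: card_image[OF assms])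
  qed (use root in auto)
  with j0 cf[of j0] show False by simp
qed

text \<open>
  Multiply the matrix on the right by \<open>W\<close>, whose first \<open>n\<close> columns are the power vectors of the
  roots and whose last \<open>m\<close> columns are unit vectors. The power vector of a root \<open>z\<close> evaluates each
  row polynomial at \<open>z\<close>, and the rows \<open>x ^ i * f\<close> evaluate to zero. So the product is block upper
  triangular: its first block is the Vandermonde matrix with column \<open>k\<close> scaled by \<open>g (z k)\<close>, its
  last block is triangular with the leading coefficient of \<open>f\<close> on the diagonal. The determinant of
  \<open>W\<close> is that of the Vandermonde matrix, which is nonzero and cancels.
\<close>

lemma det_resultant_matrix:
  fixes f g :: "'a::field poly"
  assumes "degree f = n" and "degree g \<le> m" and "inj_on z {..<n}"
    and root: "\<And>k. k < n \<Longrightarrow> poly f (z k) = 0"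
  shows "det (resultant_matrix n m f g) = lead_coeff f ^ m * (\<Prod>k<n. poly g (z k))"
proof -
  \<comment> \<open>The polynomial whose coefficients form row \<open>i\<close>.\<close>
  define R where "R = (\<lambda>i. if i < n then monom 1 i * g else monom 1 (i - n) * f)"
  define S where "S = resultant_matrix n m f g"
  define V where "V = Matrix.mat n n (\<lambda>(j, k). z k ^ j)"
  define W where "W = four_block_mat V (0\<^sub>m n m) (Matrix.mat m n (\<lambda>(j, k). z k ^ (n + j))) (1\<^sub>m m)"
  define A where "A = V * mat_diag n (\<lambda>k. poly g (z k))"
  define B where "B = Matrix.mat n m (\<lambda>(i, k). coeff (R i) (n + k))"
  define T where "T = Matrix.mat m m (\<lambda>(i, k). coeff (R (n + i)) (n + k))"
  have S: "S \<in> carrier_mat (n + m) (n + m)" and V: "V \<in> carrier_mat n n"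
    and T: "T \<in> carrier_mat m m" and B: "B \<in> carrier_mat n m"
    by (auto simp: S_def resultant_matrix_def V_def T_def B_def)
  have A: "A = Matrix.mat n n (\<lambda>(i, k). z k ^ i * poly g (z k))"
    unfolding A_def mat_diag_mult_right[OF V] by (auto simp: V_def)
  have A': "A \<in> carrier_mat n n"
    by (simp add: A)
  have W: "W \<in> carrier_mat (n + m) (n + m)"
    unfolding W_def using V by (intro four_block_carrier_mat) auto
  have W_entry: "W $$ (j, k) = (if k < n then z k ^ j else if j = k then 1 else 0)"
    if "j < n + m" "k < n + m" for j k
    using that by (auto simp: W_def V_def)
  have deg: "degree (R i) < n + m" if "i < n + m" for i
  proof (cases "i < n")
    case True
    have "degree (monom 1 i * g) \<le> degree (monom (1::'a) i) + degree g"
      by (rule degree_mult_le)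
    with True assms(2) show ?thesis
      by (simp add: R_def degree_monom_eq)
  next
    case False
    have "degree (monom 1 (i - n) * f) \<le> degree (monom (1::'a) (i - n)) + degree f"
      by (rule degree_mult_le)
    with False assms(1) that show ?thesis
      by (simp add: R_def degree_monom_eq)
  qed
  have SW: "S * W = four_block_mat A B (0\<^sub>m m n) T"
  proof (rule eq_matI)
    fix i k
    assume "i < dim_row (four_block_mat A B (0\<^sub>m m n) T)"
      and "k < dim_col (four_block_mat A B (0\<^sub>m m n) T)"
    then have ik: "i < n + m" "k < n + m"
      using A' T by auto
    have "(S * W) $$ (i, k) = (\<Sum>j<n + m. coeff (R i) j * W $$ (j, k))"
      using ik S W
      by (auto simp: scalar_prod_def S_def resultant_matrix_def R_def atLeast0LessThan intro!: sum.cong)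
    also have "\<dots> = (if k < n then poly (R i) (z k) else coeff (R i) k)"
    proof (cases "k < n")
      case True
      then show ?thesis
        using ik by (simp add: W_entry poly_eq_sum_lessThan[OF deg[OF ik(1)]])
    next
      case False
      then have "(\<Sum>j<n + m. coeff (R i) j * W $$ (j, k)) = (\<Sum>j<n + m. if j = k then coeff (R i) j else 0)"
        using ik by (intro sum.cong) (auto simp: W_entry)
      with False ik show ?thesis by simp
    qed
    also have "\<dots> = four_block_mat A B (0\<^sub>m m n) T $$ (i, k)"
      using ik T B A' by (auto simp: A B_def T_def R_def poly_monom root)
    finally show "(S * W) $$ (i, k) = four_block_mat A B (0\<^sub>m m n) T $$ (i, k)" .
  qed (use S W A' T in auto)
  have detT: "det T = lead_coeff f ^ m"
  proof -
    have T_entry: "T $$ (i, k) = (if n + k < i then 0 else coeff f (n + k - i))"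
      if "i < m" "k < m" for i k
      using that by (simp add: T_def R_def coeff_monom_mult)
    have "det T = prod_list (diag_mat T)"
      using T assms(1) by (intro det_lower_triangular[of m]) (auto simp: T_entry coeff_eq_0)
    also have "\<dots> = (\<Prod>i<m. lead_coeff f)"
      using T assms(1) by (simp add: prod_list_diag_prod T_entry atLeast0LessThan)
    finally show ?thesis by simp
  qed
  have "det (mat_diag n (\<lambda>k. poly g (z k))) = (\<Prod>k<n. poly g (z k))"
    by (subst det_upper_triangular[of _ n])
      (auto simp: mat_diag_def prod_list_diag_prod atLeast0LessThan)
  then have detA: "det A = det V * (\<Prod>k<n. poly g (z k))"
    unfolding A_def using V by (simp add: det_mult[of _ n])
  have "det S * det V = det S * det W"
    unfolding W_def using V by (subst det_four_block_mat_upper_right_zero[of _ n _ m]) auto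
  also have "\<dots> = det A * det T"
    unfolding det_mult[OF S W, symmetric] SW
    by (rule det_four_block_mat_lower_left_zero[OF A' B refl T])
  finally have "det S * det V = lead_coeff f ^ m * (\<Prod>k<n. poly g (z k)) * det V"
    by (simp add: detA detT mult_ac)
  then show ?thesis
    using det_vandermonde_nonzero[OF assms(3)] by (simp add: S_def V_def)
qed

lemma resultant_with_roots_integer:
  fixes f g :: "int poly" and Z :: "complex set"
  assumes "degree f = card Z" and "finite Z" and "degree g \<le> m"
    and "\<And>z. z \<in> Z \<Longrightarrow> poly (map_poly of_int f) z = 0"
  shows "of_int (lead_coeff f) ^ m * (\<Prod>z\<in>Z. poly (map_poly of_int g) z) \<in> \<int>"
proof -
  obtain h where h: "bij_betw h {..<card Z} Z"
    using ex_bij_betw_nat_finite[OF assms(2)] by (auto simp: atLeast0LessThan)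
  let ?f = "map_poly of_int f :: complex poly" and ?g = "map_poly of_int g :: complex poly"
  have "resultant_matrix (card Z) m ?f ?g = map_mat of_int (resultant_matrix (card Z) m f g)"
    by (rule eq_matI) (auto simp: resultant_matrix_def coeff_monom_mult coeff_map_poly)
  then have "det (resultant_matrix (card Z) m ?f ?g) = of_int (det (resultant_matrix (card Z) m f g))"
    by (simp add: of_int_hom.hom_det)
  moreover have "det (resultant_matrix (card Z) m ?f ?g)
      = lead_coeff ?f ^ m * (\<Prod>k<card Z. poly ?g (h k))"
    using h assms by (intro det_resultant_matrix) (auto simp: bij_betw_def degree_map_poly)
  moreover have "(\<Prod>k<card Z. poly ?g (h k)) = (\<Prod>z\<in>Z. poly ?g z)"
    by (rule prod.reindex_bij_betw[OF h])
  ultimately show ?thesis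
    by (simp add: degree_map_poly coeff_map_poly)
qed

section \<open>Polynomials with simple zeros\<close>

text \<open>
  The zeros form a set, not a multiset: a product of linear factors over it has simple zeros.
\<close>

lemma coeff_prod_linear_top:
  fixes A :: "'a::idom set"
  assumes "finite A"
  shows "coeff (\<Prod>z\<in>A. [:-z, 1:]) (card A) = 1"
  using assms lead_coeff_prod[of "\<lambda>z. [:-z, 1:]" A] by (simp add: degree_prod_sum_eq)

lemma coeff_prod_linear_second:
  fixes A :: "'a::idom set"
  assumes "finite A" "A \<noteq> {}"
  shows "coeff (\<Prod>z\<in>A. [:-z, 1:]) (card A - 1) = - \<Sum>A"
  using assms
proof (induction rule: finite_ne_induct)
  case (insert x A)
  then obtain k where k: "card A = Suc k"
    by (metis card_eq_0_iff not0_implies_Suc)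
  with insert coeff_prod_linear_top[of A] show ?case
    by simp
qed simp

lemma poly_pderiv_prod_linear:
  fixes A :: "'a::idom set"
  assumes "finite A" "z \<in> A"
  shows "poly (pderiv (\<Prod>w\<in>A. [:-w, 1:])) z = (\<Prod>w\<in>A - {z}. z - w)"
proof -
  have "(\<Prod>w\<in>A. [:-w, 1:]) = [:-z, 1:] * (\<Prod>w\<in>A - {z}. [:-w, 1:])"
    by (rule prod.remove[OF assms])
  then show ?thesis
    by (simp only: pderiv_mult) (simp add: pderiv_pCons poly_prod)
qed

text \<open>
  The resultant with the derivative, in its product form, is a nonzero integer. Its factor
  \<open>lead_coeff P ^ (n - 1)\<close> comes from the degree of the derivative, and each of the \<open>n\<close> values of
  the derivative contributes one more leading coefficient.
\<close>

lemma discriminant_lower_bound: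
  fixes P :: "int poly" and Z :: "complex set"
  assumes "finite Z" and "P \<noteq> 0"
    and fact: "map_poly of_int P = Polynomial.smult (of_int (lead_coeff P)) (\<Prod>z\<in>Z. [:-z, 1:])"
  shows "1 \<le> \<bar>real_of_int (lead_coeff P)\<bar> ^ (2 * card Z - 1) * (\<Prod>z\<in>Z. \<Prod>w\<in>Z - {z}. norm (z - w))"
proof -
  let ?a = "of_int (lead_coeff P) :: complex"
  have a: "?a \<noteq> 0" using assms(2) by simp
  have "degree P = degree (map_poly of_int P :: complex poly)"
    by (simp add: degree_map_poly)
  also have "\<dots> = card Z"
    using a by (simp add: fact degree_prod_sum_eq)
  finally have deg: "degree P = card Z" .
  have root: "poly (map_poly of_int P) z = 0" if "z \<in> Z" for z
    using that assms(1) by (simp add: fact poly_prod prod_zero_iff)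
  have der: "poly (map_poly of_int (pderiv P)) z = ?a * (\<Prod>w\<in>Z - {z}. z - w)" if "z \<in> Z" for z
  proof -
    have "map_poly of_int (pderiv P) = pderiv (map_poly of_int P :: complex poly)"
      by (rule poly_eqI) (simp add: coeff_map_poly coeff_pderiv)
    then show ?thesis
      using that assms(1) by (simp add: fact pderiv_smult poly_pderiv_prod_linear)
  qed
  let ?r = "?a ^ (card Z - 1) * (\<Prod>z\<in>Z. poly (map_poly of_int (pderiv P)) z)"
  have "?r \<in> \<int>"
    using assms(1) deg root
    by (intro resultant_with_roots_integer) (auto simp: degree_pderiv)
  then obtain N :: int where N: "?r = of_int N" by (auto elim: Ints_cases)
  have r: "?r = ?a ^ (card Z - 1 + card Z) * (\<Prod>z\<in>Z. \<Prod>w\<in>Z - {z}. z - w)"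
    using der by (simp add: prod.distrib power_add cong: prod.cong)
  have "?r \<noteq> 0"
    unfolding r using a assms(1) by (auto simp: prod_zero_iff)
  with N have "N \<noteq> 0" by auto
  then have "1 \<le> \<bar>real_of_int N\<bar>" by linarith
  also have "\<dots> = norm ?r" unfolding N by simp
  also have "\<dots> = \<bar>real_of_int (lead_coeff P)\<bar> ^ (card Z - 1 + card Z)
      * (\<Prod>z\<in>Z. \<Prod>w\<in>Z - {z}. norm (z - w))"
    unfolding r by (simp add: norm_mult norm_power prod_norm[symmetric])
  also have "card Z - 1 + card Z = 2 * card Z - 1" by simp
  finally show ?thesis .
qed

section \<open>Logarithmic energy in the unit disk\<close>

text \<open>
  The pseudo-hyperbolic distance is at most one, because the two squared moduli differ by
  \<open>(1 - \<bar>u\<bar>\<^sup>2) (1 - \<bar>v\<bar>\<^sup>2)\<close>.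
\<close>

lemma norm_diff_le_norm_one_minus_cnj:
  assumes "norm u \<le> 1" "norm v \<le> 1"
  shows "norm (u - v) \<le> norm (1 - u * cnj v)"
proof -
  have expand: "(1 - (a * c + b * d))\<^sup>2 + (a * d - b * c)\<^sup>2 - ((a - c)\<^sup>2 + (b - d)\<^sup>2)
      = (1 - (a\<^sup>2 + b\<^sup>2)) * (1 - (c\<^sup>2 + d\<^sup>2))" for a b c d :: real
    by (simp add: power2_eq_square ring_distribs)
  have "(norm (1 - u * cnj v))\<^sup>2 - (norm (u - v))\<^sup>2 = (1 - (norm u)\<^sup>2) * (1 - (norm v)\<^sup>2)"
    using expand[of "Re u" "Re v" "Im u" "Im v"] unfolding cmod_power2 by simp
  also have "\<dots> \<ge> 0"
    using assms by (intro mult_nonneg_nonneg) (simp_all add: power_le_one)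
  finally have "(norm (u - v))\<^sup>2 \<le> (norm (1 - u * cnj v))\<^sup>2" by simp
  then show ?thesis
    by (rule power2_le_imp_le) simp
qed

lemma ln_norm_one_minus_sums:
  fixes u :: complex
  assumes "norm u < 1"
  shows "(\<lambda>m. - Re (u ^ m) / real m) sums ln (norm (1 - u))"
proof -
  have "1 - u \<noteq> 0" using assms by auto
  then have "Re (ln (1 - u)) = ln (norm (1 - u))"
    by (rule Re_Ln)
  moreover have "(\<lambda>m. - (u ^ m) / of_nat m) sums ln (1 - u)"
    using Ln_series'[of "-u"] assms by simp
  then have "(\<lambda>m. Re (- (u ^ m) / of_nat m)) sums Re (ln (1 - u))"
    by (rule sums_Re)
  ultimately show ?thesis
    by (simp only: Re_divide_of_nat uminus_complex.sel)
qed

text \<open>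
  Expanding the logarithm gives minus the sum over \<open>m \<ge> 1\<close> of \<open>s ^ m / m\<close> times the squared modulus of
  the \<open>m\<close>-th power sum. All terms have the same sign, so keeping only \<open>m = 1\<close> bounds the whole
  series.
\<close>

lemma kernel_energy_le:
  fixes Z :: "complex set"
  assumes "finite Z" and disk: "\<And>z. z \<in> Z \<Longrightarrow> norm z \<le> 1" and s: "0 \<le> s" "s < 1"
  shows "(\<Sum>z\<in>Z. \<Sum>w\<in>Z. ln (norm (1 - of_real s * z * cnj w))) \<le> - s * (norm (\<Sum>Z))\<^sup>2"
proof -
  \<comment> \<open>At \<open>m = 0\<close> division by zero makes this term vanish, as the logarithm series requires.\<close>
  define b where "b = (\<lambda>m. s ^ m / real m * (norm (\<Sum>z\<in>Z. z ^ m))\<^sup>2)"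
  have lt1: "norm (of_real s * z * cnj w) < 1" if "z \<in> Z" "w \<in> Z" for z w
  proof -
    have "norm (of_real s * z * cnj w) = s * (norm z * norm w)"
      using s by (simp add: norm_mult)
    also have "\<dots> \<le> s * 1"
      using disk[OF that(1)] disk[OF that(2)] s by (intro mult_left_mono mult_le_one) auto
    finally show ?thesis using s by simp
  qed
  have "(\<lambda>m. \<Sum>z\<in>Z. \<Sum>w\<in>Z. - Re ((of_real s * z * cnj w) ^ m) / real m)
      sums (\<Sum>z\<in>Z. \<Sum>w\<in>Z. ln (norm (1 - of_real s * z * cnj w)))"
    by (intro sums_sum ln_norm_one_minus_sums lt1)
  also have "(\<lambda>m. \<Sum>z\<in>Z. \<Sum>w\<in>Z. - Re ((of_real s * z * cnj w) ^ m) / real m) = (\<lambda>m. - b m)"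
  proof
    fix m
    let ?p = "\<Sum>z\<in>Z. z ^ m"
    have "(\<Sum>z\<in>Z. \<Sum>w\<in>Z. - Re ((of_real s * z * cnj w) ^ m) / real m)
        = - Re (\<Sum>z\<in>Z. \<Sum>w\<in>Z. (of_real s * z * cnj w) ^ m) / real m"
      by (simp add: sum_divide_distrib[symmetric] sum_negf)
    also have "(\<Sum>z\<in>Z. \<Sum>w\<in>Z. (of_real s * z * cnj w) ^ m) = of_real (s ^ m) * (\<Sum>z\<in>Z. \<Sum>w\<in>Z. z ^ m * cnj (w ^ m))"
      by (simp add: power_mult_distrib sum_distrib_left mult.assoc)
    also have "(\<Sum>z\<in>Z. \<Sum>w\<in>Z. z ^ m * cnj (w ^ m)) = ?p * cnj ?p"
      by (simp only: sum_product cnj_sum)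
    also have "?p * cnj ?p = of_real ((norm ?p)\<^sup>2)"
      by (rule complex_norm_square[symmetric])
    also have "- Re (of_real (s ^ m) * of_real ((norm ?p)\<^sup>2)) / real m = - b m"
      by (simp add: b_def flip: of_real_mult)
    finally show "(\<Sum>z\<in>Z. \<Sum>w\<in>Z. - Re ((of_real s * z * cnj w) ^ m) / real m) = - b m" .
  qed
  finally have sums: "b sums (- (\<Sum>z\<in>Z. \<Sum>w\<in>Z. ln (norm (1 - of_real s * z * cnj w))))"
    by (drule_tac sums_minus) simp
  have "b 1 \<le> suminf b"
    using sum_le_suminf[OF sums_summable[OF sums], of "{1}"] s by (simp add: b_def)
  with sums_unique[OF sums] show ?thesis
    by (simp add: b_def)
qed

text \<open>
  Apply the kernel estimate to the points contracted by \<open>sqrt s\<close>. Each of the \<open>n\<close> diagonal terms of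
  the kernel is at least \<open>ln (1 - s)\<close>, and the contraction changes the logarithm of each of the
  \<open>n (n - 1)\<close> distances by \<open>ln (1 / s) / 2\<close>.
\<close>

lemma sum_norm_le_energy:
  fixes Z :: "complex set"
  assumes fin: "finite Z" and disk: "\<And>z. z \<in> Z \<Longrightarrow> norm z \<le> 1" and s: "0 < s" "s < 1"
  shows "s * (norm (\<Sum>Z))\<^sup>2 + (\<Sum>z\<in>Z. \<Sum>w\<in>Z - {z}. ln (norm (z - w)))
    \<le> real (card Z) * ln (1 / (1 - s)) + real (card Z * (card Z - 1)) / 2 * ln (1 / s)"
proof -
  let ?K = "\<lambda>z w. ln (norm (1 - of_real s * z * cnj w))"
  let ?n = "card Z"
  have diag: "ln (1 - s) \<le> ?K z z" if "z \<in> Z" for z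
  proof -
    have "1 - s \<le> 1 - s * (norm z)\<^sup>2"
      using disk[OF that] s by (simp add: power_le_one mult_left_le)
    also have "\<dots> \<le> norm (1 - of_real s * z * cnj z)"
    proof -
      have "1 - of_real s * z * cnj z = of_real (1 - s * (norm z)\<^sup>2)"
        by (simp only: mult.assoc complex_norm_square[symmetric]) simp
      then show ?thesis
        by (metis abs_ge_self norm_of_real)
    qed
    finally show ?thesis using s by (intro ln_mono) auto
  qed
  have off: "ln (norm (z - w)) \<le> ?K z w + ln (1 / s) / 2" if "z \<in> Z" "w \<in> Z - {z}" for z w
  proof -
    define r where "r = sqrt s"
    have r: "0 < r" "r < 1" "r * r = s" using s by (auto simp: r_def)
    have "r * norm (z - w) = norm (of_real r * z - of_real r * w)"
      using r by (simp add: norm_mult flip: right_diff_distrib)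
    also have "\<dots> \<le> norm (1 - of_real r * z * cnj (of_real r * w))"
      using disk[of z] disk[of w] that r
      by (intro norm_diff_le_norm_one_minus_cnj) (auto simp: norm_mult intro!: mult_le_one)
    also have "of_real r * z * cnj (of_real r * w) = of_real s * z * cnj w"
      by (simp flip: r(3))
    finally have le: "r * norm (z - w) \<le> norm (1 - of_real s * z * cnj w)" .
    have pos: "0 < norm (z - w)" using that by auto
    have "ln r + ln (norm (z - w)) = ln (r * norm (z - w))"
      using r pos by (simp add: ln_mult)
    also have "\<dots> \<le> ?K z w"
      using le r pos by (intro ln_mono) auto
    finally show ?thesis
      using s by (simp add: r_def ln_sqrt ln_div)
  qed
  have "(\<Sum>z\<in>Z. \<Sum>w\<in>Z - {z}. ln (norm (z - w)))
      \<le> (\<Sum>z\<in>Z. \<Sum>w\<in>Z - {z}. ?K z w + ln (1 / s) / 2)"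
    by (intro sum_mono off)
  also have "\<dots> = (\<Sum>z\<in>Z. (\<Sum>w\<in>Z - {z}. ?K z w)) + real (?n * (?n - 1)) / 2 * ln (1 / s)"
    using fin by (simp add: sum.distrib)
  also have "(\<Sum>z\<in>Z. (\<Sum>w\<in>Z - {z}. ?K z w)) = (\<Sum>z\<in>Z. (\<Sum>w\<in>Z. ?K z w) - ?K z z)"
    using fin by (intro sum.cong) (auto simp: sum_diff1)
  also have "\<dots> = (\<Sum>z\<in>Z. \<Sum>w\<in>Z. ?K z w) - (\<Sum>z\<in>Z. ?K z z)"
    by (rule sum_subtractf)
  finally have "(\<Sum>z\<in>Z. \<Sum>w\<in>Z - {z}. ln (norm (z - w)))
      \<le> (\<Sum>z\<in>Z. \<Sum>w\<in>Z. ?K z w) - (\<Sum>z\<in>Z. ?K z z) + real (?n * (?n - 1)) / 2 * ln (1 / s)" .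
  moreover have "(\<Sum>z\<in>Z. \<Sum>w\<in>Z. ?K z w) \<le> - s * (norm (\<Sum>Z))\<^sup>2"
    using s by (intro kernel_energy_le fin disk) auto
  moreover have "real ?n * ln (1 - s) \<le> (\<Sum>z\<in>Z. ?K z z)"
    using sum_mono[of Z "\<lambda>_. ln (1 - s)" "\<lambda>z. ?K z z"] diag by simp
  moreover have "ln (1 / (1 - s)) = - ln (1 - s)"
    using s by (simp add: ln_div)
  ultimately show ?thesis by simp
qed

section \<open>The second coefficient\<close>

text \<open>
  The two terms on the right of \<open>sum_norm_le_energy\<close> are balanced by \<open>s = 1 - 1/n\<close>: the first becomes
  \<open>n ln n\<close>, the second at most \<open>n/2\<close>. The arithmetic lower bound for the energy costs \<open>2 n ln n\<close>.
  With \<open>s \<ge> 1/2\<close> and \<open>ln n \<ge> 1\<close>, the latter from \<open>n \<ge> 3 \<ge> exp 1\<close>, the constant is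
  \<open>2 (3 + 1/2) = 7\<close>.
\<close>

lemma norm_sum_roots_le:
  fixes P :: "int poly" and Z :: "complex set"
  assumes fin: "finite Z" and "P \<noteq> 0" and disk: "\<And>z. z \<in> Z \<Longrightarrow> norm z \<le> 1"
    and fact: "map_poly of_int P = Polynomial.smult (of_int (lead_coeff P)) (\<Prod>z\<in>Z. [:-z, 1:])"
    and lead: "\<bar>lead_coeff P\<bar> \<le> int (card Z)" and n: "card Z \<ge> 3"
  shows "(norm (\<Sum>Z))\<^sup>2 \<le> 7 * (real (card Z) * ln (real (card Z)))"
proof -
  define n where "n = card Z"
  define a where "a = \<bar>real_of_int (lead_coeff P)\<bar>"
  define D where "D = (\<Sum>z\<in>Z. \<Sum>w\<in>Z - {z}. ln (norm (z - w)))"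
  define s where "s = 1 - 1 / real n"
  have n3: "n \<ge> 3" using n by (simp add: n_def)
  have a: "1 \<le> a" "a \<le> real n"
  proof -
    have "1 \<le> \<bar>lead_coeff P\<bar>" using assms(2) by (simp add: int_one_le_iff_zero_less)
    with lead show "1 \<le> a" "a \<le> real n"
      unfolding a_def n_def by linarith+
  qed
  have s: "1 / 2 \<le> s" "s < 1" using n3 by (auto simp: s_def field_simps)
  have lnn: "1 \<le> ln (real n)"
  proof -
    have "exp 1 \<le> real n" using exp_le n3 by linarith
    then show ?thesis using n3 by (subst ln_ge_iff) auto
  qed
  have "0 \<le> ln (a ^ (2 * n - 1) * (\<Prod>z\<in>Z. \<Prod>w\<in>Z - {z}. norm (z - w)))"
    using discriminant_lower_bound[OF fin assms(2) fact] by (simp add: a_def n_def)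
  also have "\<dots> = real (2 * n - 1) * ln a + D"
  proof -
    have "ln (\<Prod>z\<in>Z. \<Prod>w\<in>Z - {z}. norm (z - w)) = (\<Sum>z\<in>Z. ln (\<Prod>w\<in>Z - {z}. norm (z - w)))"
      using fin by (intro ln_prod prod_pos) auto
    also have "\<dots> = D"
      unfolding D_def using fin by (intro sum.cong ln_prod) auto
    finally have "ln (\<Prod>z\<in>Z. \<Prod>w\<in>Z - {z}. norm (z - w)) = D" .
    moreover have "0 < (\<Prod>z\<in>Z. \<Prod>w\<in>Z - {z}. norm (z - w))"
      by (intro prod_pos) auto
    ultimately show ?thesis
      using a by (simp add: ln_mult ln_realpow)
  qed
  finally have D: "0 \<le> real (2 * n - 1) * ln a + D" .
  have "real (2 * n - 1) * ln a \<le> 2 * real n * ln (real n)"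
    using a n3 by (intro mult_mono) auto
  with D have D': "- D \<le> 2 * real n * ln (real n)" by linarith
  have E: "s * (norm (\<Sum>Z))\<^sup>2 + D \<le> real n * ln (1 / (1 - s)) + real (n * (n - 1)) / 2 * ln (1 / s)"
    unfolding D_def n_def using s by (intro sum_norm_le_energy fin disk) auto
  have "1 / s = 1 + 1 / (real n - 1)" using n3 by (simp add: s_def field_simps)
  then have "ln (1 / s) \<le> 1 / (real n - 1)"
    using n3 ln_add_one_self_le_self[of "1 / (real n - 1)"] by simp
  then have "real (n * (n - 1)) / 2 * ln (1 / s) \<le> real (n * (n - 1)) / 2 * (1 / (real n - 1))"
    by (intro mult_left_mono) auto
  also have "\<dots> = real n / 2"
  proof -
    have cancel: "x * y / 2 * (1 / y) = x / 2" if "y \<noteq> 0" for x y :: real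
      using that by simp
    have "real (n * (n - 1)) = real n * (real n - 1)"
      using n3 by (simp add: of_nat_diff)
    then show ?thesis
      using cancel[of "real n - 1" "real n"] n3 by (simp only:)
  qed
  finally have F: "real (n * (n - 1)) / 2 * ln (1 / s) \<le> real n / 2" .
  have G: "1 / (1 - s) = real n" using n3 by (simp add: s_def)
  have "1 / 2 * (norm (\<Sum>Z))\<^sup>2 \<le> s * (norm (\<Sum>Z))\<^sup>2"
    using s by (intro mult_right_mono) auto
  also have "\<dots> \<le> 3 * (real n * ln (real n)) + real n / 2"
    using E F D' unfolding G by linarith
  also have "real n / 2 \<le> (real n * ln (real n)) / 2"
    using lnn by (simp add: mult_le_cancel_left1)
  finally show ?thesis by (simp add: n_def)
qed

theorem theorem2p5:
  fixes M :: real and n :: nat and P :: "int poly"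
  assumes "M > 0"
    and "P \<in> int_polys_simple_zeros n closed_unit_disk M"
    and "real n \<ge> max M 55"
  shows "real_of_int \<bar>coeff P (n - 1)\<bar> \<le> 8 * M * sqrt (real n * ln (real n))"
proof -
  let ?p = "map_poly of_int P :: complex poly"
  define Z where "Z = {z. poly ?p z = 0}"
  have P: "P \<noteq> 0" "degree P = n" and lead: "real_of_int \<bar>lead_coeff P\<bar> \<le> M"
    and roots: "\<And>z. z \<in> Z \<Longrightarrow> norm z \<le> 1 \<and> Polynomial.order z ?p = 1"
    using assms(2) by (auto simp: int_polys_simple_zeros_def closed_unit_disk_def Z_def)
  have p0: "?p \<noteq> 0" using P(1) by (simp add: map_poly_eq_0_iff)
  have fin: "finite Z" unfolding Z_def by (rule poly_roots_finite[OF p0])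
  have lc: "lead_coeff ?p = of_int (lead_coeff P)"
    by (simp add: degree_map_poly coeff_map_poly)
  have "?p = Polynomial.smult (lead_coeff ?p) (\<Prod>z\<in>Z. [:-z, 1:] ^ Polynomial.order z ?p)"
    unfolding Z_def by (rule complex_poly_decompose[symmetric])
  also have "(\<Prod>z\<in>Z. [:-z, 1:] ^ Polynomial.order z ?p) = (\<Prod>z\<in>Z. [:-z, 1:])"
    using roots by (intro prod.cong) auto
  finally have fact: "?p = Polynomial.smult (of_int (lead_coeff P)) (\<Prod>z\<in>Z. [:-z, 1:])"
    unfolding lc .
  have "n = degree ?p" using P by (simp add: degree_map_poly)
  also have "\<dots> = card Z" unfolding fact using P(1) by (simp add: degree_prod_sum_eq)
  finally have card: "card Z = n" by simp
  have n: "n \<ge> 55" "M \<le> real n" using assms(3) by auto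
  have "\<bar>lead_coeff P\<bar> \<le> int n" using lead n(2) by linarith
  then have "(norm (\<Sum>Z))\<^sup>2 \<le> 7 * (real n * ln (real n))"
    using norm_sum_roots_le[OF fin P(1) _ fact] roots n(1) by (simp add: card)
  also have "\<dots> \<le> 64 * (real n * ln (real n))"
    using n(1) by (intro mult_right_mono) auto
  finally have "norm (\<Sum>Z) \<le> sqrt (64 * (real n * ln (real n)))"
    by (rule real_le_rsqrt)
  also have "\<dots> = 8 * sqrt (real n * ln (real n))"
    by (simp only: real_sqrt_mult) simp
  finally have sum: "norm (\<Sum>Z) \<le> 8 * sqrt (real n * ln (real n))" .
  have "Z \<noteq> {}" using card n(1) by auto
  then have "of_int (coeff P (n - 1)) = of_int (lead_coeff P) * - \<Sum>Z"
    using arg_cong[OF fact, of "\<lambda>q. coeff q (n - 1)"] coeff_prod_linear_second[OF fin] card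
    by (simp add: coeff_map_poly)
  from arg_cong[OF this, of norm]
  have "real_of_int \<bar>coeff P (n - 1)\<bar> = real_of_int \<bar>lead_coeff P\<bar> * norm (\<Sum>Z)"
    by (simp add: norm_mult)
  also have "\<dots> \<le> M * (8 * sqrt (real n * ln (real n)))"
    using lead sum assms(1) by (intro mult_mono) auto
  finally show ?thesis by (simp add: mult_ac)
qed

end
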